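(* Every complete (commutative, infinite) idempotent semifield is algebraically closed.
   Context: A semiring is a commutative monoid $(S,+,0)$ with an associative multiplication having identity $1$, distributing over $+$, and with $0$ absorbing. A semifield is a semiring with $1\neq 0$ in which every nonzero element has a multiplicative inverse; it is idempotent if $x+x=x$ for all $x$. All idempotent semifields are assumed commutative and infinite. An idempotent semifield $K$ is ordered by $x\leqslant y \iff x+y=y$. $K$ is complete if every subset of $K$ that is bounded above has a supremum (equivalently, every nonempty subset has an infimum). A polynomial $p\in K[X]$ is a formal polynomial $p=\sum_{j\in\mathbb{N}}p_jX^j$ (eventually zero sequence of coefficients). Its polynomial function is $\widehat p:K\to K$, $\widehat p(x)=\sum_j p_jx^j$. $K$ is algebraically closed if for every $p\in K[X]$ of degree $n>0$ there are $r_1,\dots,r_n\in K$ with $\widehat p(x)=p_n(x+r_1)\cdots(x+r_n)$ for all $x\in K$. *)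

theory Defs
  imports "HOL-Computational_Algebra.Polynomial"
begin

(* The axiom 1 \<noteq> 0 is part of comm_semiring_1. *)
class comm_semifield = comm_semiring_1 +
  assumes ex_mult_inverse: "x \<noteq> 0 \<Longrightarrow> \<exists>y. x * y = 1"

class idempotent_semifield = comm_semifield + ord +
  assumes add_idem: "x + x = x"
    and less_eq_iff_add: "x \<le> y \<longleftrightarrow> x + y = y"
    and less_iff_le_neq: "x < y \<longleftrightarrow> x \<le> y \<and> x \<noteq> y"
begin

subclass order
proof
  fix x y z :: 'a
  show "x \<le> x"
    by (simp add: less_eq_iff_add add_idem)
  show antisym: "x = y" if "x \<le> y" "y \<le> x" for x y
    using that by (metis less_eq_iff_add add.commute)
  show "x \<le> z" if "x \<le> y" "y \<le> z"
    using that by (metis less_eq_iff_add add.assoc)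
  show "x < y \<longleftrightarrow> x \<le> y \<and> \<not> y \<le> x"
    using antisym by (metis less_iff_le_neq \<open>x \<le> x\<close>)
qed

end

(* The empty set is included; its supremum is 0. *)
definition complete_semifield :: "'a::idempotent_semifield itself \<Rightarrow> bool" where
  "complete_semifield _ \<longleftrightarrow>
    (\<forall>A :: 'a set. bdd_above A \<longrightarrow>
      (\<exists>s. (\<forall>a\<in>A. a \<le> s) \<and> (\<forall>u. (\<forall>a\<in>A. a \<le> u) \<longrightarrow> s \<le> u)))"

(* The factorization is an identity of polynomial functions, not of formal
   polynomials: over an idempotent semifield distinct polynomials may induce
   the same function. *)
definition algebraically_closed_semifield :: "'a::idempotent_semifield itself \<Rightarrow> bool" where
  "algebraically_closed_semifield _ \<longleftrightarrow>
    (\<forall>p :: 'a poly. degree p > 0 \<longrightarrow>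
      (\<exists>r :: nat \<Rightarrow> 'a. \<forall>x.
        poly p x = lead_coeff p * (\<Prod>i = 1..degree p. x + r i)))"

end

theory Submission
  imports Defs
begin

text \<open>
  Given \<open>p\<close> of degree \<open>n\<close>, replace each coefficient \<open>p\<^sub>j\<close> with \<open>j < n\<close> by the largest
  \<open>q\<^sub>j\<close> such that \<open>q\<^sub>j x\<^sup>j \<le> p(x)\<close> for all \<open>x\<close>; this does not change the polynomial
  function.  Since powers are additive in a commutative idempotent semifield, so is \<open>x \<mapsto> p(x)\<close>,
  whence \<open>p(x \<and> y) p(x \<or> y) \<le> p(x) p(y)\<close> for the lattice operations \<open>x \<or> y = x + y\<close>
  and \<open>x \<and> y = x y / (x + y)\<close>.  This makes \<open>q\<close> log-concave, and then the quotients
  \<open>q\<^bsub>i-1\<^esub> / q\<^sub>i\<close> are the required roots.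
\<close>

section \<open>Order and cancellation in idempotent semifields\<close>

context comm_semifield
begin

subclass semiring_1_no_zero_divisors
proof
  fix a b :: 'a
  assume "a \<noteq> 0" "b \<noteq> 0"
  show "a * b \<noteq> 0"
  proof
    assume *: "a * b = 0"
    obtain c where "a * c = 1" using ex_mult_inverse \<open>a \<noteq> 0\<close> by blast
    then have "b = c * (a * b)"
      by (metis mult.assoc mult.commute mult_1_right)
    with * \<open>b \<noteq> 0\<close> show False by simp
  qed
qed

end

context idempotent_semifield
begin

subclass canonically_ordered_monoid_add
  by standard (metis add_assoc add_idem less_eq_iff_add)

subclass ordered_comm_semiring
  by standard (metis less_eq_iff_add distrib_left)

lemma add_le_iff: "x + y \<le> z \<longleftrightarrow> x \<le> z \<and> y \<le> z"
  by (metis add_assoc add_commute add_idem less_eq_iff_add)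

lemma sum_le_iff: "finite A \<Longrightarrow> sum f A \<le> z \<longleftrightarrow> (\<forall>a\<in>A. f a \<le> z)"
  by (induction A rule: finite_induct) (auto simp: add_le_iff)

lemma le_addI1: "x \<le> y \<Longrightarrow> x \<le> y + z"
  by (metis add_le_iff order_refl order_trans)

lemma le_addI2: "x \<le> z \<Longrightarrow> x \<le> y + z"
  by (metis le_addI1 add_commute)

lemma member_le_sum_idem: "finite A \<Longrightarrow> a \<in> A \<Longrightarrow> f a \<le> sum f A"
  using sum_le_iff[of A f "sum f A"] by simp

lemma power_mono_idem: "x \<le> y \<Longrightarrow> x ^ n \<le> y ^ n"
  by (induction n) (auto intro: mult_mono)

lemma mult_le_cancel_left_idem:
  assumes "a \<noteq> 0" "a * x \<le> a * y"
  shows "x \<le> y"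
proof -
  obtain c where "a * c = 1" using ex_mult_inverse assms(1) by blast
  then have "c * (a * z) = z" for z
    by (metis mult.assoc mult.commute mult_1_right)
  then show ?thesis
    using mult_left_mono[OF assms(2), of c] by simp
qed

lemma of_nat_idem: "n > 0 \<Longrightarrow> of_nat n = 1"
proof (induction n)
  case (Suc n)
  then show ?case by (cases n) (auto simp: add_idem)
qed simp

end

lemma power_mult_power_le_add_power:
  fixes x y :: "'a::idempotent_semifield"
  shows "x ^ i * y ^ j \<le> (x + y) ^ (i + j)"
  unfolding power_add by (intro mult_mono power_mono_idem le_addI1 le_addI2) auto

text \<open>
  In the expansion of \<open>(x + y)\<^bsup>2n\<^esup>\<close>, each monomial is divisible by \<open>x\<^sup>n\<close> or by \<open>y\<^sup>n\<close>;
  then cancel \<open>(x + y)\<^sup>n\<close>.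
\<close>

lemma add_power_idem:
  fixes x y :: "'a::idempotent_semifield"
  assumes "n > 0"
  shows "(x + y) ^ n = x ^ n + y ^ n"
proof (rule antisym)
  show "x ^ n + y ^ n \<le> (x + y) ^ n"
    unfolding add_le_iff by (intro conjI power_mono_idem le_addI1 le_addI2) auto
  show "(x + y) ^ n \<le> x ^ n + y ^ n"
  proof (cases "x + y = 0")
    case True
    then show ?thesis using assms by (simp add: power_0_left)
  next
    case False
    have "x ^ k * y ^ (n + n - k) \<le> (x + y) ^ n * (x ^ n + y ^ n)" if "k \<le> n + n" for k
    proof (cases "n \<le> k")
      case True
      then have "x ^ k * y ^ (n + n - k) = (x ^ (k - n) * y ^ (n + n - k)) * x ^ n"
        by (metis le_add_diff_inverse power_add mult.commute mult.left_commute)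
      also have "\<dots> \<le> (x + y) ^ n * x ^ n"
        using power_mult_power_le_add_power[of x "k - n" y "n + n - k"] True that
        by (intro mult_right_mono) auto
      finally show ?thesis by (simp add: distrib_left le_addI1)
    next
      case False
      then have "n + n - k = n + (n - k)" by simp
      then have "x ^ k * y ^ (n + n - k) = (x ^ k * y ^ (n - k)) * y ^ n"
        by (simp add: power_add algebra_simps)
      also have "\<dots> \<le> (x + y) ^ n * y ^ n"
        using power_mult_power_le_add_power[of x k y "n - k"] False
        by (intro mult_right_mono) auto
      finally show ?thesis by (simp add: distrib_left le_addI2)
    qed
    then have "(x + y) ^ (n + n) \<le> (x + y) ^ n * (x ^ n + y ^ n)"
      unfolding binomial_ring by (subst sum_le_iff) (auto simp: of_nat_idem)
    then show ?thesis
      unfolding power_add by (rule mult_le_cancel_left_idem[rotated]) (use False in auto)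
  qed
qed

lemma poly_mono_idem:
  fixes p :: "'a::idempotent_semifield poly"
  assumes "x \<le> y"
  shows "poly p x \<le> poly p y"
  unfolding poly_altdef by (intro sum_mono mult_left_mono power_mono_idem assms) auto

lemma poly_add_arg_idem:
  fixes p :: "'a::idempotent_semifield poly"
  shows "poly p (x + y) = poly p x + poly p y"
proof -
  \<comment> \<open>For \<open>i = 0\<close> the powers are all 1, so idempotence replaces
    additivity.\<close>
  have "coeff p i * (x + y) ^ i = coeff p i * x ^ i + coeff p i * y ^ i" for i
    by (cases "i = 0") (simp_all add: add_idem add_power_idem distrib_left)
  then show ?thesis
    by (simp add: poly_altdef sum.distrib)
qed

section \<open>Log-concavity of the maximal coefficients\<close>

text \<open>Dividing by \<open>u\<close> turns a condition on \<open>c * u\<close> into an upper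
  bound on \<open>c\<close>, the form in which it passes to suprema.\<close>

lemma mult_le_iff_ex_quotient:
  fixes u v :: "'a::idempotent_semifield"
  assumes "u \<noteq> 0"
  obtains w where "\<And>c. c * u \<le> v \<longleftrightarrow> c \<le> w"
proof -
  obtain u' where u': "u * u' = 1" using ex_mult_inverse assms by blast
  then have "u * (v * u') = v" by (metis mult.left_commute mult_1_right)
  then have "c * u \<le> v \<longleftrightarrow> c \<le> v * u'" for c
    using mult_le_cancel_left_idem[OF assms, of c "v * u'"]
      mult_left_mono[of c "v * u'" u] by (auto simp: mult.commute)
  then show ?thesis using that by blast
qed

text \<open>The supremum of the admissible coefficients is again admissible: for
  \<open>x ^ j\<close> nonzero, the condition at \<open>x\<close> is just an upper bound on
  \<open>c\<close>. Evaluation at 1 shows that the supremum exists.\<close>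

lemma ex_max_coeff:
  fixes p :: "'a::idempotent_semifield poly"
  assumes "complete_semifield TYPE('a)"
  obtains q where "\<And>c. (\<forall>x. c * x ^ j \<le> poly p x) \<longleftrightarrow> c \<le> q"
proof -
  define A where "A = {c. \<forall>x. c * x ^ j \<le> poly p x}"
  have "c \<le> poly p 1" if "c \<in> A" for c
    using that unfolding A_def by (auto dest: spec[of _ 1])
  then have "bdd_above A" by (auto simp: bdd_above_def)
  then obtain q where upper: "\<And>a. a \<in> A \<Longrightarrow> a \<le> q"
    and least: "\<And>u. (\<And>a. a \<in> A \<Longrightarrow> a \<le> u) \<Longrightarrow> q \<le> u"
    using assms unfolding complete_semifield_def by metis
  have "q * x ^ j \<le> poly p x" for x
  proof (cases "x ^ j = 0")
    case False
    obtain w where w: "\<And>c. c * x ^ j \<le> poly p x \<longleftrightarrow> c \<le> w"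
      using mult_le_iff_ex_quotient[OF False] by blast
    show ?thesis unfolding w by (rule least) (use w in \<open>auto simp: A_def\<close>)
  next
    case True
    then show ?thesis by (simp only: mult_zero_right zero_le)
  qed
  then have "(\<forall>x. c * x ^ j \<le> poly p x) \<longleftrightarrow> c \<le> q" for c
    using upper[of c] by (auto simp: A_def intro: order_trans[OF mult_right_mono])
  then show ?thesis using that by blast
qed

text \<open>With \<open>z\<close> and \<open>w\<close> the meet and join of \<open>x\<close> and
  \<open>y\<close>, the monomial in \<open>x\<close> and \<open>y\<close> is at most
  \<open>z ^ i * w ^ Suc k\<close>, so the bounds on \<open>a\<close> and \<open>b\<close> apply at
  \<open>z\<close> and \<open>w\<close>.\<close>

lemma mult_monomials_le_poly:
  fixes p :: "'a::idempotent_semifield poly"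
  assumes a: "\<And>x. a * x ^ i \<le> poly p x" and b: "\<And>x. b * x ^ Suc k \<le> poly p x"
    and "i < k"
  shows "a * b * (x ^ Suc i * y ^ k) \<le> poly p x * poly p y"
proof (cases "x = 0 \<or> y = 0")
  case True
  then show ?thesis using \<open>i < k\<close> by (auto simp: power_0_left)
next
  case False
  define w where "w = x + y"
  have "w \<noteq> 0" using False by (simp add: w_def)
  then obtain w' where w': "w * w' = 1" using ex_mult_inverse by blast
  \<comment> \<open>The meet, chosen so that \<open>w * z = x * y\<close>.\<close>
  define z where "z = x * y * w'"
  have wz: "w * z = x * y" using w' unfolding z_def by (metis mult.left_commute mult_1_right)
  have xy: "x \<le> w" "y \<le> w" by (auto simp: w_def le_addI1 le_addI2)
  have "w * z \<le> w * x" "w * z \<le> w * y"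
    unfolding wz using mult_left_mono[OF xy(2), of x] mult_left_mono[OF xy(1), of y]
    by (auto simp: ac_simps)
  then have z: "z \<le> x" "z \<le> y"
    using mult_le_cancel_left_idem[OF \<open>w \<noteq> 0\<close>] by auto
  have "x ^ Suc i * y ^ k = (x * y) ^ Suc i * y ^ (k - Suc i)"
    using \<open>i < k\<close> by (simp add: power_mult_distrib mult.assoc flip: power_add power_Suc)
  also have "\<dots> \<le> (w * z) ^ Suc i * w ^ (k - Suc i)"
    unfolding wz by (intro mult_left_mono power_mono_idem xy) auto
  also have "\<dots> = z ^ Suc i * (w ^ Suc i * w ^ (k - Suc i))"
    by (simp only: power_mult_distrib ac_simps)
  also have "\<dots> = z ^ Suc i * w ^ k"
    using \<open>i < k\<close> by (simp flip: power_add power_Suc)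
  also have "\<dots> = z ^ i * w ^ k * z" by (simp add: ac_simps)
  \<comment> \<open>Trading one factor \<open>z\<close> for \<open>w\<close> shifts the exponents
    from \<open>Suc i\<close>, \<open>k\<close> to \<open>i\<close>, \<open>Suc k\<close>.\<close>
  also have "\<dots> \<le> z ^ i * w ^ k * w"
    using z xy by (intro mult_left_mono) auto
  finally have "a * b * (x ^ Suc i * y ^ k) \<le> a * b * (z ^ i * w ^ k * w)"
    by (intro mult_left_mono) auto
  also have "\<dots> = (a * z ^ i) * (b * w ^ Suc k)" by (simp add: ac_simps)
  also have "\<dots> \<le> poly p z * poly p w"
    by (intro mult_mono a b) auto
  also have "\<dots> = poly p z * poly p x + poly p z * poly p y"
    by (simp add: w_def poly_add_arg_idem distrib_left)
  also have "\<dots> \<le> poly p x * poly p y"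
    unfolding add_le_iff
    using mult_right_mono[OF poly_mono_idem[OF z(2), of p], of "poly p x"]
      mult_right_mono[OF poly_mono_idem[OF z(1), of p], of "poly p y"]
    by (simp add: ac_simps)
  finally show ?thesis .
qed

text \<open>Maximality is used once per variable. For fixed \<open>y\<close>, the quotient of
  \<open>a * b * y ^ k\<close> by \<open>poly p y\<close> is admissible in degree
  \<open>Suc i\<close>, hence at most \<open>s\<close>; then \<open>a * b\<close> divided by
  \<open>s\<close> is admissible in degree \<open>k\<close>, hence at most \<open>t\<close>.\<close>

lemma max_coeff_log_concave:
  fixes p :: "'a::idempotent_semifield poly"
  assumes a: "\<And>x. a * x ^ i \<le> poly p x" and b: "\<And>x. b * x ^ Suc k \<le> poly p x"
    and s: "\<And>c. (\<And>x. c * x ^ Suc i \<le> poly p x) \<Longrightarrow> c \<le> s"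
    and t: "\<And>c. (\<And>x. c * x ^ k \<le> poly p x) \<Longrightarrow> c \<le> t"
    and "i < k" and "p \<noteq> 0"
  shows "a * b \<le> s * t"
proof -
  have "a * b * y ^ k \<le> s * poly p y" for y
  proof (cases "poly p y = 0")
    case True
    \<comment> \<open>The leading monomial lies below \<open>poly p y\<close>, so it vanishes
      too.\<close>
    have "lead_coeff p * y ^ degree p \<le> poly p y"
      unfolding poly_altdef by (rule member_le_sum_idem) auto
    then have "y = 0" using True \<open>p \<noteq> 0\<close> by auto
    then show ?thesis using \<open>i < k\<close> by (simp add: power_0_left)
  next
    case False
    obtain u where u: "poly p y * u = 1" using ex_mult_inverse False by blast
    have "a * b * y ^ k * u \<le> s"
    proof (rule s)
      fix x
      have "a * b * y ^ k * u * x ^ Suc i = a * b * (x ^ Suc i * y ^ k) * u"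
        by (simp add: ac_simps)
      also have "\<dots> \<le> poly p x * poly p y * u"
        by (intro mult_right_mono mult_monomials_le_poly a b \<open>i < k\<close>) auto
      finally show "a * b * y ^ k * u * x ^ Suc i \<le> poly p x"
        using u by (simp add: mult.assoc)
    qed
    then have "a * b * y ^ k * u * poly p y \<le> s * poly p y"
      by (intro mult_right_mono) auto
    moreover have "a * b * y ^ k * u * poly p y = a * b * y ^ k * (poly p y * u)"
      by (simp only: ac_simps)
    ultimately show ?thesis using u by simp
  qed
  note * = this
  show ?thesis
  proof (cases "s = 0")
    case True
    then show ?thesis using *[of 1] by simp
  next
    case False
    obtain u where u: "s * u = 1" using ex_mult_inverse False by blast
    have "a * b * u \<le> t"
    proof (rule t)
      fix y
      have "u * (a * b * y ^ k) \<le> u * (s * poly p y)"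
        by (intro mult_left_mono *) auto
      also have "\<dots> = (s * u) * poly p y" by (simp only: ac_simps)
      finally show "a * b * u * y ^ k \<le> poly p y"
        using u by (simp add: ac_simps)
    qed
    then have "s * (a * b * u) \<le> s * t" by (intro mult_left_mono) auto
    moreover have "s * (a * b * u) = a * b * (s * u)" by (simp only: ac_simps)
    ultimately show ?thesis using u by simp
  qed
qed

section \<open>Factorization of log-concave polynomials\<close>

lemma power_le_prod_add:
  fixes x :: "'a::idempotent_semifield"
  shows "x ^ m \<le> (\<Prod>i = 1..m. x + r i)"
proof (induction m)
  case (Suc m)
  then have "x ^ m * x \<le> (\<Prod>i = 1..m. x + r i) * (x + r (Suc m))"
    by (intro mult_mono le_addI1) auto
  then show ?case by (simp add: mult.commute)
qed simp

text \<open>The identity is proved for every partial sum, by induction on its length. A new factor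
  \<open>x + r (Suc m)\<close> contributes the old sum, through the choice of root, and a multiple
  of \<open>x * P\<close> that log-concavity controls.\<close>

lemma log_concave_factorization:
  fixes q :: "nat \<Rightarrow> 'a::idempotent_semifield"
  assumes concave: "\<And>i k. i < k \<Longrightarrow> k < n \<Longrightarrow> q i * q (Suc k) \<le> q (Suc i) * q k"
    and nonzero: "q n \<noteq> 0"
  shows "\<exists>r. \<forall>x. (\<Sum>j\<le>n. q j * x ^ j) = q n * (\<Prod>i = 1..n. x + r i)"
proof -
  have step: "q i = 0" if "q (Suc i) = 0" "i < n" for i
  proof (cases "Suc i = n")
    case False
    \<comment> \<open>Pairing with the nonzero \<open>q n\<close> makes zeros propagate
      downwards.\<close>
    then have "q i * q n \<le> q (Suc i) * q (n - 1)"
      using concave[of i "n - 1"] that by simp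
    then show ?thesis using that nonzero by simp
  qed (use that nonzero in auto)
  have zeros: "q i = 0" if "i \<le> m" "m \<le> n" "q m = 0" for i m
    using that by (induction rule: inc_induct) (auto intro: step)
  \<comment> \<open>Where \<open>q i\<close> vanishes, so does \<open>q (i - 1)\<close>, and the root must be chosen to be zero.\<close>
  have "\<exists>r. r * q i = q (i - 1) \<and> (q i = 0 \<longrightarrow> r = 0)" if "0 < i" "i \<le> n" for i
  proof (cases "q i = 0")
    case True
    then show ?thesis using zeros[of "i - 1" i] that by auto
  next
    case False
    obtain u where "q i * u = 1" using ex_mult_inverse False by blast
    then have "(q (i - 1) * u) * q i = q (i - 1)"
      by (metis mult.assoc mult.commute mult_1_right)
    then show ?thesis using False by blast
  qed
  then obtain r where r: "\<And>i. 0 < i \<Longrightarrow> i \<le> n \<Longrightarrow> r i * q i = q (i - 1)"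
    and r0: "\<And>i. 0 < i \<Longrightarrow> i \<le> n \<Longrightarrow> q i = 0 \<Longrightarrow> r i = 0"
    by metis
  have "(\<Sum>j\<le>m. q j * x ^ j) = q m * (\<Prod>i = 1..m. x + r i)" if "m \<le> n" for m x
    using that
  proof (induction m)
    case (Suc m)
    define P where "P = (\<Prod>i = 1..m. x + r i)"
    define S where "S = (\<Sum>j\<le>m. q j * x ^ j)"
    have IH: "S = q m * P" using Suc by (simp add: P_def S_def)
    have P: "x ^ m \<le> P"
      unfolding P_def by (rule power_le_prod_add)
    have "q (Suc m) * (\<Prod>i = 1..Suc m. x + r i) = (x * q (Suc m) + r (Suc m) * q (Suc m)) * P"
      by (simp add: P_def algebra_simps)
    also have "\<dots> = q (Suc m) * x * P + S"
      using r[of "Suc m"] Suc.prems by (simp add: IH algebra_simps)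
    also have "\<dots> = S + q (Suc m) * x ^ Suc m"
    proof (rule antisym)
      have "q (Suc m) * x * P \<le> S + q (Suc m) * x ^ Suc m"
      proof (cases "q m = 0")
        case True
        \<comment> \<open>All earlier coefficients vanish as well, so every root so far is
          zero.\<close>
        have "r i = 0" if "i \<in> {1..m}" for i
          using that zeros[of i m] r0[of i] True Suc.prems by auto
        then have "P = x ^ m" by (simp add: P_def)
        then show ?thesis by (simp add: le_addI2 mult.assoc)
      next
        case False
        \<comment> \<open>Multiplying by \<open>q m\<close> turns \<open>P\<close> into the sum
          \<open>S\<close>, so that log-concavity can be applied term by term.\<close>
        have "q m * (q (Suc m) * x * P) = S * (q (Suc m) * x)"
          by (simp add: IH ac_simps)
        also have "\<dots> = (\<Sum>j\<le>m. q j * q (Suc m) * x ^ Suc j)"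
          unfolding S_def sum_distrib_right by (simp add: ac_simps)
        also have "\<dots> \<le> q m * (S + q (Suc m) * x ^ Suc m)"
        proof (subst sum_le_iff; (intro ballI)?)
          fix j assume j: "j \<in> {..m}"
          have "q j * q (Suc m) \<le> q m * q (Suc j)"
            using concave[of j m] j Suc.prems by (cases "j = m") (auto simp: mult.commute)
          then have "q j * q (Suc m) * x ^ Suc j \<le> q m * (q (Suc j) * x ^ Suc j)"
            unfolding mult.assoc[symmetric] by (rule mult_right_mono) simp
          also have "\<dots> \<le> q m * (\<Sum>j\<le>Suc m. q j * x ^ j)"
            using j by (intro mult_left_mono member_le_sum_idem) auto
          finally show "q j * q (Suc m) * x ^ Suc j \<le> q m * (S + q (Suc m) * x ^ Suc m)"
            by (simp add: S_def)
        qed simp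
        finally show ?thesis using mult_le_cancel_left_idem False by blast
      qed
      then show "q (Suc m) * x * P + S \<le> S + q (Suc m) * x ^ Suc m"
        by (simp add: add_le_iff le_addI1)
      have "q (Suc m) * x ^ Suc m \<le> q (Suc m) * x * P"
        using mult_left_mono[OF P, of "q (Suc m) * x"] by (simp add: mult.assoc)
      then show "S + q (Suc m) * x ^ Suc m \<le> q (Suc m) * x * P + S"
        by (simp add: add_le_iff le_addI1 le_addI2)
    qed
    finally show ?case by (simp add: S_def)
  qed simp
  then show ?thesis by blast
qed

theorem corollary5p15:
  assumes "infinite (UNIV :: 'a::idempotent_semifield set)"
    and "complete_semifield TYPE('a)"
  shows "algebraically_closed_semifield TYPE('a)"
  unfolding algebraically_closed_semifield_def
proof (intro allI impI)
  fix p :: "'a poly"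
  assume deg: "degree p > 0"
  define n where "n = degree p"
  have "p \<noteq> 0" using deg by auto
  have coeff_le: "coeff p j * x ^ j \<le> poly p x" for j x
  proof (cases "j \<le> degree p")
    case True
    then show ?thesis unfolding poly_altdef by (intro member_le_sum_idem) auto
  qed (simp add: coeff_eq_0)
  have "\<exists>q. \<forall>c. (\<forall>x. c * x ^ j \<le> poly p x) \<longleftrightarrow> c \<le> q" for j
    using ex_max_coeff[OF assms(2), of j p] by metis
  then obtain q where q: "\<And>j c. (\<forall>x. c * x ^ j \<le> poly p x) \<longleftrightarrow> c \<le> q j"
    by metis
  \<comment> \<open>The leading coefficient is kept, as the factorization requires. Log-concavity
    survives: index \<open>n\<close> can occur only as \<open>Suc k\<close> on the smaller side,
    where admissibility suffices; maximality is needed only at \<open>Suc i\<close> and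
    \<open>k\<close>, both below \<open>n\<close>.\<close>
  define q' where "q' j = (if j = n then lead_coeff p else q j)" for j
  have q'_le: "q' j * x ^ j \<le> poly p x" for j x
    using q[of "q j" j] coeff_le[of n x] by (auto simp: q'_def n_def)
  have coeff_le_q': "coeff p j \<le> q' j" for j
    using q[of "coeff p j" j] coeff_le[of j] by (auto simp: q'_def n_def)
  have "\<exists>r. \<forall>x. (\<Sum>j\<le>n. q' j * x ^ j) = q' n * (\<Prod>i = 1..n. x + r i)"
  proof (rule log_concave_factorization)
    fix i k assume ik: "i < k" "k < n"
    show "q' i * q' (Suc k) \<le> q' (Suc i) * q' k"
    proof (rule max_coeff_log_concave[OF q'_le q'_le _ _ ik(1) \<open>p \<noteq> 0\<close>])
      show "c \<le> q' (Suc i)" if "\<And>x. c * x ^ Suc i \<le> poly p x" for c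
        using q[of c "Suc i"] that ik by (auto simp: q'_def)
      show "c \<le> q' k" if "\<And>x. c * x ^ k \<le> poly p x" for c
        using q[of c k] that ik by (auto simp: q'_def)
    qed
  qed (use \<open>p \<noteq> 0\<close> in \<open>simp add: q'_def\<close>)
  \<comment> \<open>Coefficients only grow, yet each monomial stays below
    \<open>poly p x\<close>.\<close>
  moreover have "(\<Sum>j\<le>n. q' j * x ^ j) = poly p x" for x
  proof (rule antisym)
    show "(\<Sum>j\<le>n. q' j * x ^ j) \<le> poly p x"
      by (subst sum_le_iff) (auto intro: q'_le)
    show "poly p x \<le> (\<Sum>j\<le>n. q' j * x ^ j)"
      unfolding poly_altdef n_def[symmetric]
      by (intro sum_mono mult_right_mono coeff_le_q') auto
  qed
  ultimately show "\<exists>r. \<forall>x. poly p x = lead_coeff p * (\<Prod>i = 1..degree p. x + r i)"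
    by (simp add: q'_def n_def)
qed

end
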